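(* Let $L_1,L_2,L_3$ be three distinct vector lines (one-dimensional linear subspaces) of the Euclidean space $\mathbb R^3$. Let $\widehat A$, $\widehat B$, $\widehat\Omega$ be the geometric angles between $L_2$ and $L_3$, between $L_3$ and $L_1$, and between $L_1$ and $L_2$ respectively. Let $\widehat A'$ be the apparent angle between $L_2$ and $L_3$ seen from $L_1$, $\widehat B'$ the apparent angle between $L_3$ and $L_1$ seen from $L_2$, and $\widehat\Omega'$ the apparent angle between $L_1$ and $L_2$ seen from $L_3$. Then the relative order of $\widehat A$ and $\widehat A'$ is the same as that of $\widehat B$ and $\widehat B'$ and as that of $\widehat\Omega$ and $\widehat\Omega'$; i.e. $$\widehat A'<\widehat A\iff\widehat B'<\widehat B\iff\widehat\Omega'<\widehat\Omega,$$ $$\widehat A'=\widehat A\iff\widehat B'=\widehat B\iff\widehat\Omega'=\widehat\Omega,$$ $$\widehat A'>\widehat A\iff\widehat B'>\widehat B\iff\widehat\Omega'>\widehat\Omega.$$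
   Context: The geometric angle between two vector lines $L,L'$ of a Euclidean space is $\arccos\frac{|a\cdot b|}{\|a\|\,\|b\|}\in[0,\pi/2]$ for arbitrary $a\in L\setminus\{0\}$, $b\in L'\setminus\{0\}$. For vector lines $L,L'$ and $L''\ne L,L'$ of $\mathbb R^3$, the apparent angle between $L$ and $L'$ seen from $L''$ is the geometric angle between the orthogonal projections of $L$ and $L'$ onto the plane $(L'')^\perp$. *)

theory Defs
  imports "HOL-Analysis.Analysis"
begin

definition vector_line :: "'a::euclidean_space set \<Rightarrow> bool" where
  "vector_line L \<longleftrightarrow> subspace L \<and> dim L = 1"

text \<open>The value does not depend on the choice of the nonzero vectors \<open>a\<close> and \<open>b\<close>, so the
  description is well defined for vector lines; see \<open>geom_angle_span\<close> below.\<close>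

definition geom_angle :: "'a::euclidean_space set \<Rightarrow> 'a set \<Rightarrow> real" where
  "geom_angle L L' =
     (THE \<theta>. \<forall>a\<in>L - {0}. \<forall>b\<in>L' - {0}. \<theta> = arccos (\<bar>a \<bullet> b\<bar> / (norm a * norm b)))"

definition orth_proj :: "'a::euclidean_space set \<Rightarrow> 'a \<Rightarrow> 'a" where
  "orth_proj W x = (THE p. p \<in> W \<and> x - p \<in> orthogonal_comp W)"

definition apparent_angle :: "(real^3) set \<Rightarrow> (real^3) set \<Rightarrow> (real^3) set \<Rightarrow> real" where
  "apparent_angle L L' L'' =
     geom_angle (orth_proj (orthogonal_comp L'') ` L) (orth_proj (orthogonal_comp L'') ` L')"

lemma vector_lineE:
  assumes "vector_line L"
  obtains a where "a \<noteq> 0" "L = span {a}"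
proof -
  from assms have s: "subspace L" and d: "dim L = 1"
    by (auto simp: vector_line_def)
  from d obtain a where a: "a \<in> L" "a \<noteq> 0"
    by (metis dim_eq_0 zero_neq_one subsetI singletonI)
  have "span {a} = span L"
    by (rule dim_eq_span) (use a d in auto)
  with s a that show thesis
    by (metis span_eq_iff)
qed

lemma geom_angle_span:
  assumes "a \<noteq> 0" "b \<noteq> 0"
  shows "geom_angle (span {a}) (span {b}) = arccos (\<bar>a \<bullet> b\<bar> / (norm a * norm b))"
  unfolding geom_angle_def
proof (rule the_equality)
  show "\<forall>x\<in>span {a} - {0}. \<forall>y\<in>span {b} - {0}.
      arccos (\<bar>a \<bullet> b\<bar> / (norm a * norm b)) = arccos (\<bar>x \<bullet> y\<bar> / (norm x * norm y))"
    using assms by (auto simp: span_singleton abs_mult split: if_splits)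
next
  fix t
  assume "\<forall>x\<in>span {a} - {0}. \<forall>y\<in>span {b} - {0}. t = arccos (\<bar>x \<bullet> y\<bar> / (norm x * norm y))"
  moreover have "a \<in> span {a} - {0}" "b \<in> span {b} - {0}"
    using assms by (auto simp: span_base)
  ultimately show "t = arccos (\<bar>a \<bullet> b\<bar> / (norm a * norm b))"
    by blast
qed

lemma orth_proj_unique:
  assumes "subspace W" "p \<in> W" "x - p \<in> orthogonal_comp W"
  shows "orth_proj W x = p"
  unfolding orth_proj_def
proof (rule the_equality)
  fix q
  assume q: "q \<in> W \<and> x - q \<in> orthogonal_comp W"
  have "p - q \<in> W"
    using assms q by (simp add: subspace_diff)
  moreover have "p - q \<in> orthogonal_comp W"
    using subspace_diff [OF subspace_orthogonal_comp, of "x - q" W "x - p"] assms q by simp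
  ultimately show "q = p"
    by (auto simp: orthogonal_comp_def orthogonal_def)
qed (use assms in auto)

lemma orth_proj_orthogonal_comp_span:
  assumes "c \<noteq> 0"
  shows "orth_proj (orthogonal_comp (span {c})) x = x - ((c \<bullet> x) / (c \<bullet> c)) *\<^sub>R c"
proof (rule orth_proj_unique)
  show "x - ((c \<bullet> x) / (c \<bullet> c)) *\<^sub>R c \<in> orthogonal_comp (span {c})"
    using assms by (auto simp: orthogonal_comp_def orthogonal_def span_singleton inner_diff_right)
  have "((c \<bullet> x) / (c \<bullet> c)) *\<^sub>R c \<in> span {c}"
    by (simp add: span_base span_mul)
  then show "x - (x - ((c \<bullet> x) / (c \<bullet> c)) *\<^sub>R c) \<in> orthogonal_comp (orthogonal_comp (span {c}))"
    using orthogonal_comp_subset by fastforce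
qed (rule subspace_orthogonal_comp)

end

(* For unit vectors u, v, w spanning the lines, put a = v \<bullet> w, b = w \<bullet> u, c = u \<bullet> v.
   The angle between the lines of v and w has cosine \<bar>a\<bar>, and their apparent angle seen
   from the line of u has cosine \<bar>a - b c\<bar> / sqrt ((1 - b^2) (1 - c^2)). Comparing squares,
   the sign of the difference of the two angles is the sign of
   (a - b c)^2 - a^2 (1 - b^2) (1 - c^2) = a^2 b^2 + b^2 c^2 + c^2 a^2 - 2 a b c - a^2 b^2 c^2,
   which is symmetric in a, b, c. *)
theory Submission
  imports Defs
begin

text \<open>With unit generators the inner products are cosines up to sign, so no norms of
  generators enter the formulas below.\<close>

lemma vector_line_unitE:
  assumes "vector_line L"
  obtains u where "norm u = 1" "L = span {u}"
proof -
  from assms obtain a where a: "a \<noteq> 0" "L = span {a}"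
    by (rule vector_lineE)
  have "span {a /\<^sub>R norm a} = span {a}"
    using a(1) by (intro span_image_scale[where S = "{a}" and c = "\<lambda>x. inverse (norm x)", simplified])
  with a show thesis
    by (intro that[of "a /\<^sub>R norm a"]) auto
qed

text \<open>For a unit vector \<open>u\<close> the projection formula loses its denominator and is
  homogeneous in its argument, so one residual vector spans the whole image.\<close>

lemma orth_proj_image_span:
  fixes u v :: "'a::euclidean_space"
  assumes "norm u = 1"
  shows "orth_proj (orthogonal_comp (span {u})) ` span {v} = span {v - (u \<bullet> v) *\<^sub>R u}"
proof -
  have "u \<noteq> 0" "u \<bullet> u = 1"
    using assms by (auto simp: norm_eq_1)
  then have "orth_proj (orthogonal_comp (span {u})) (k *\<^sub>R v) = k *\<^sub>R (v - (u \<bullet> v) *\<^sub>R u)" for k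
    by (simp add: orth_proj_orthogonal_comp_span scaleR_diff_right)
  then show ?thesis
    by (simp add: span_singleton image_image)
qed

text \<open>Guarantees that the projection of a line distinct from the viewing line is again a line,
  so that \<open>geom_angle_span\<close> applies to it. A zero residual would make \<open>v\<close>
  a nonzero multiple of \<open>u\<close>.\<close>

lemma orth_residual_nonzero:
  fixes u v :: "'a::euclidean_space"
  assumes "norm v = 1" "span {u} \<noteq> span {v}"
  shows "v - (u \<bullet> v) *\<^sub>R u \<noteq> 0"
proof
  assume "v - (u \<bullet> v) *\<^sub>R u = 0"
  then have v: "v = (u \<bullet> v) *\<^sub>R u"
    by simp
  with assms(1) have "u \<bullet> v \<noteq> 0"
    by auto
  then have "span {(u \<bullet> v) *\<^sub>R u} = span {u}"
    by (intro span_image_scale[where S = "{u}" and c = "\<lambda>x. u \<bullet> v", simplified])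
  with v assms(2) show False
    by metis
qed

text \<open>Equivalently (1 - a^2) (1 - b^2) (1 - c^2) - G, where G = 1 - a^2 - b^2 - c^2 + 2 a b c
  is the Gram determinant of three unit vectors with pairwise inner products a, b, c.\<close>

definition angle_discriminant :: "real \<Rightarrow> real \<Rightarrow> real \<Rightarrow> real" where
  "angle_discriminant a b c =
     a\<^sup>2 * b\<^sup>2 + b\<^sup>2 * c\<^sup>2 + c\<^sup>2 * a\<^sup>2 - 2 * a * b * c - a\<^sup>2 * b\<^sup>2 * c\<^sup>2"

lemma angle_discriminant_rotate: "angle_discriminant a b c = angle_discriminant b c a"
  by (simp add: angle_discriminant_def algebra_simps)

lemma apparent_angle_compare:
  fixes u v w :: "real^3"
  assumes unit: "norm u = 1" "norm v = 1" "norm w = 1"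
    and ne: "span {u} \<noteq> span {v}" "span {u} \<noteq> span {w}"
  defines "F \<equiv> angle_discriminant (v \<bullet> w) (w \<bullet> u) (u \<bullet> v)"
    and "\<theta> \<equiv> geom_angle (span {v}) (span {w})"
    and "\<theta>' \<equiv> apparent_angle (span {v}) (span {w}) (span {u})"
  shows "\<theta>' < \<theta> \<longleftrightarrow> F > 0" and "\<theta>' > \<theta> \<longleftrightarrow> F < 0"
proof -
  define a b c where abc: "a = v \<bullet> w" "b = w \<bullet> u" "c = u \<bullet> v"
  define p q where pq: "p = v - c *\<^sub>R u" "q = w - b *\<^sub>R u"
  define x where "x = \<bar>p \<bullet> q\<bar> / (norm p * norm q)"
  have nz: "p \<noteq> 0" "q \<noteq> 0"
    using orth_residual_nonzero[of v u] orth_residual_nonzero[of w u] assms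
    by (auto simp: pq abc inner_commute)
  have sq: "u \<bullet> u = 1" "v \<bullet> v = 1" "w \<bullet> w = 1"
    using unit by (auto simp: norm_eq_1)
  have vw: "\<theta> = arccos \<bar>a\<bar>"
    unfolding \<theta>_def using unit by (subst geom_angle_span) (auto simp: abc)
  have pp: "\<theta>' = arccos x"
    unfolding \<theta>'_def apparent_angle_def x_def using unit nz
    by (simp add: orth_proj_image_span geom_angle_span pq abc inner_commute)
  have np: "(norm p)\<^sup>2 = 1 - c\<^sup>2" and nq: "(norm q)\<^sup>2 = 1 - b\<^sup>2" and ip: "p \<bullet> q = a - b * c"
    unfolding power2_norm_eq_inner pq
    by (simp_all add: inner_diff_left inner_diff_right sq abc inner_commute power2_eq_square)
  \<comment> \<open>Read backwards, \<open>np\<close> and \<open>nq\<close> turn the factors into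
    squared norms of the nonzero residuals.\<close>
  have pos: "0 < (1 - b\<^sup>2) * (1 - c\<^sup>2)"
    using nz by (simp flip: np nq)
  have "x\<^sup>2 = (a - b * c)\<^sup>2 / ((1 - b\<^sup>2) * (1 - c\<^sup>2))"
    by (simp add: x_def power_divide power_mult_distrib np nq ip mult.commute)
  then have "x\<^sup>2 - a\<^sup>2 = F / ((1 - b\<^sup>2) * (1 - c\<^sup>2))"
    using pos unfolding F_def abc[symmetric] angle_discriminant_def
    by (simp add: field_simps) (simp add: power2_eq_square algebra_simps)
  then have sgn: "x\<^sup>2 > a\<^sup>2 \<longleftrightarrow> F > 0" "x\<^sup>2 < a\<^sup>2 \<longleftrightarrow> F < 0"
    using pos by (smt (verit) zero_less_divide_iff divide_less_0_iff)+
  \<comment> \<open>Both cosines must lie in the interval on which arccos is strictly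
    decreasing.\<close>
  have x: "0 \<le> x" "x \<le> 1"
    using Cauchy_Schwarz_ineq2[of p q] nz by (auto simp: x_def divide_le_eq)
  have a: "\<bar>a\<bar> \<le> 1"
    using Cauchy_Schwarz_ineq2[of v w] unit by (simp add: abc)
  \<comment> \<open>The nonnegative \<open>x\<close> is written with an absolute value to fit
    \<open>abs_le_square_iff\<close>, which passes to squares.\<close>
  have "\<theta>' < \<theta> \<longleftrightarrow> \<bar>a\<bar> < \<bar>x\<bar>" "\<theta>' > \<theta> \<longleftrightarrow> \<bar>a\<bar> > \<bar>x\<bar>"
    using x a by (simp_all add: vw pp arccos_less_mono)
  with sgn show "\<theta>' < \<theta> \<longleftrightarrow> F > 0" "\<theta>' > \<theta> \<longleftrightarrow> F < 0"
    by (simp_all add: abs_le_square_iff flip: not_le)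
qed

theorem theorem3p9p2:
  fixes L\<^sub>1 L\<^sub>2 L\<^sub>3 :: "(real^3) set" and A B \<Omega> A' B' \<Omega>' :: real
  assumes "vector_line L\<^sub>1" and "vector_line L\<^sub>2" and "vector_line L\<^sub>3"
    and "L\<^sub>1 \<noteq> L\<^sub>2" and "L\<^sub>2 \<noteq> L\<^sub>3" and "L\<^sub>3 \<noteq> L\<^sub>1"
    and "A = geom_angle L\<^sub>2 L\<^sub>3"
    and "B = geom_angle L\<^sub>3 L\<^sub>1"
    and "\<Omega> = geom_angle L\<^sub>1 L\<^sub>2"
    and "A' = apparent_angle L\<^sub>2 L\<^sub>3 L\<^sub>1"
    and "B' = apparent_angle L\<^sub>3 L\<^sub>1 L\<^sub>2"
    and "\<Omega>' = apparent_angle L\<^sub>1 L\<^sub>2 L\<^sub>3"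
  shows "((A' < A \<longleftrightarrow> B' < B) \<and> (B' < B \<longleftrightarrow> \<Omega>' < \<Omega>)) \<and>
         ((A' = A \<longleftrightarrow> B' = B) \<and> (B' = B \<longleftrightarrow> \<Omega>' = \<Omega>)) \<and>
         ((A' > A \<longleftrightarrow> B' > B) \<and> (B' > B \<longleftrightarrow> \<Omega>' > \<Omega>))"
proof -
  obtain u v w where u: "norm u = 1" "L\<^sub>1 = span {u}" and v: "norm v = 1" "L\<^sub>2 = span {v}"
    and w: "norm w = 1" "L\<^sub>3 = span {w}"
    using assms(1-3) by (metis vector_line_unitE)
  define F where "F = angle_discriminant (v \<bullet> w) (w \<bullet> u) (u \<bullet> v)"
  \<comment> \<open>These are the argument orders produced by viewing from \<open>v\<close> and from
    \<open>w\<close>.\<close>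
  have F: "F = angle_discriminant (w \<bullet> u) (u \<bullet> v) (v \<bullet> w)"
    "F = angle_discriminant (u \<bullet> v) (v \<bullet> w) (w \<bullet> u)"
    unfolding F_def by (metis angle_discriminant_rotate)+
  have "A' < A \<longleftrightarrow> F > 0" "A' > A \<longleftrightarrow> F < 0"
    using apparent_angle_compare[of u v w] assms u v w by (auto simp: F_def)
  moreover have "B' < B \<longleftrightarrow> F > 0" "B' > B \<longleftrightarrow> F < 0"
    using apparent_angle_compare[of v w u] assms u v w by (auto simp: F(1))
  moreover have "\<Omega>' < \<Omega> \<longleftrightarrow> F > 0" "\<Omega>' > \<Omega> \<longleftrightarrow> F < 0"
    using apparent_angle_compare[of w u v] assms u v w by (auto simp: F(2))
  \<comment> \<open>The sign of \<open>F\<close> decides both strict comparisons for each pair; the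
    equalities follow by trichotomy.\<close>
  ultimately show ?thesis
    by (smt (verit))
qed

end
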